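(* Let $X$ be a zero mean random vector in $\mathbb{R}^d$ with covariance $\Sigma = \mathbf{E}XX^{\top}$ which is sub-exponential in the sense that for some $\kappa > 0$, \[ \|\langle X, y \rangle\|_{\psi_1} \le \kappa\sqrt{y^{\top}\Sigma y} \quad \text{for all } y \in \mathbb{R}^d. \] Then, for any $t \ge 1$, with probability at least $1 - \exp(-t)$, \[ \|X\| \le 8\kappa\left(\sqrt{t\operatorname{Tr}(\Sigma)} + t\sqrt{\|\Sigma\|}\right). \]
   Context: $\|\cdot\|$ denotes the operator norm of a matrix and the Euclidean norm of a vector; $\langle\cdot,\cdot\rangle$ is the standard inner product on $\mathbb{R}^d$. For a random variable $Y$ and $\alpha\in[1,2]$, $\|Y\|_{\psi_\alpha} = \inf\{c > 0: \mathbf{E}\exp(|Y|^\alpha/c^{\alpha}) \le 2\}$; here $\alpha=1$. *)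

theory Defs
  imports "HOL-Probability.Probability"
begin

text \<open>The Orlicz norm takes values in \<^typ>\<open>ennreal\<close>, so that it is infinite when no admissible
  \<open>c\<close> exists (a real-valued infimum of the empty set would be an unspecified number). For the same
  reason the expectation is the nonnegative integral, which is infinite when
  \<open>exp (\<bar>Y\<bar>\<^sup>\<alpha> / c\<^sup>\<alpha>)\<close> is not integrable.\<close>

definition psi_norm :: "'a measure \<Rightarrow> real \<Rightarrow> ('a \<Rightarrow> real) \<Rightarrow> ennreal" where
  "psi_norm M \<alpha> Y =
     Inf {ennreal c | c. 0 < c \<and>
       (\<integral>\<^sup>+ \<omega>. ennreal (exp (\<bar>Y \<omega>\<bar> powr \<alpha> / c powr \<alpha>)) \<partial>M) \<le> 2}"

definition outer_prod :: "real ^ 'd \<Rightarrow> real ^ 'd ^ 'd" where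
  "outer_prod x = (columnvector x :: real ^ 1 ^ 'd) ** (rowvector x :: real ^ 'd ^ 1)"

end

theory Submission
  imports Defs
begin

text \<open>The norm of \<open>X\<close> is compared with an exponential average of the linear functionals
  \<open>\<langle>X, y\<rangle>\<close> over a standard Gaussian vector \<open>y\<close> that is independent of \<open>X\<close> and restricted to the
  ellipsoid \<open>A = {y. y\<^sup>T \<Sigma> y < R}\<close>. Put \<open>c = \<kappa> \<surd>R\<close>. For \<open>y \<in> A\<close> the hypothesis on the Orlicz norm
  gives \<open>E exp (\<bar>\<langle>X, y\<rangle>\<bar> / c) \<le> 2\<close>, so by Tonelli the random variable
  \<open>H = \<integral>\<^sub>A exp (\<bar>\<langle>X, y\<rangle>\<bar> / c) d\<gamma>(y)\<close> satisfies \<open>E H \<le> 2\<close>.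

  Conversely \<open>H\<close> is large wherever \<open>\<parallel>X\<parallel>\<close> is. Let \<open>v\<close> have length \<open>s\<close> and the direction of \<open>X\<close>, and let
  \<open>G = {y. y\<^sup>T \<Sigma> y < 2 Tr \<Sigma>}\<close>, a symmetric set whose Gaussian measure is at least one half by Markov's
  inequality, because the Gaussian mean of \<open>y\<^sup>T \<Sigma> y\<close> is \<open>Tr \<Sigma>\<close>. As \<open>\<Sigma>\<close> is positive semidefinite,
  \<open>v + G \<subseteq> A\<close> as soon as \<open>R \<ge> 2 s\<^sup>2 \<parallel>\<Sigma>\<parallel> + 4 Tr \<Sigma>\<close>. Moving the Gaussian measure by \<open>v\<close> costs a
  factor \<open>exp (- s\<^sup>2 / 2)\<close> and a factor exponential in a linear functional of \<open>y\<close>; over the symmetric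
  set \<open>G\<close> the exponential of a linear functional averages to at least 1, since \<open>cosh \<ge> 1\<close>. Therefore
  \<open>H \<ge> exp (s \<parallel>X\<parallel> / c - s\<^sup>2 / 2) / 2\<close> (lemma \<open>exp_norm_le_nn_integral_std_gauss\<close>), and Markov's
  inequality for \<open>H\<close> yields the tail bound of lemma \<open>prob_norm_gt_le\<close>.

  The theorem is the case \<open>s\<^sup>2 = 2t\<close>, \<open>R = 8 (t \<parallel>\<Sigma>\<parallel> + Tr \<Sigma>)\<close>. This \<open>R\<close> is twice the least
  admissible value, and the constant 8 then makes the exponent \<open>s \<parallel>X\<parallel> / c\<close> at least \<open>4t\<close>
  wherever the asserted bound fails, so that this happens with probability at most
  \<open>4 exp (- 3t) \<le> exp (- t)\<close>. If \<open>Tr \<Sigma> = 0\<close>, then \<open>E \<parallel>X\<parallel>\<^sup>2 = 0\<close> and \<open>X\<close> vanishes almost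
  surely.\<close>

section \<open>The standard Gaussian measure on a Euclidean space\<close>

lemma has_bochner_integral_lborel_prod:
  fixes f :: "'b::euclidean_space \<Rightarrow> real \<Rightarrow> real"
  assumes f: "\<And>b. b \<in> Basis \<Longrightarrow> integrable lborel (f b)"
  shows "has_bochner_integral lborel (\<lambda>x::'b. \<Prod>b\<in>Basis. f b (x \<bullet> b))
           (\<Prod>b\<in>Basis. integral\<^sup>L lborel (f b))"
proof -
  interpret product_sigma_finite "\<lambda>b::'b. lborel :: real measure"
    by standard
  have [measurable]: "f b \<in> borel_measurable borel" if "b \<in> Basis" for b
    using borel_measurable_integrable[OF f[OF that]] by simp
  have m: "(\<lambda>x::'b. \<Prod>b\<in>Basis. f b (x \<bullet> b)) \<in> borel_measurable borel"
    by measurable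
  have m': "(\<lambda>g. \<Sum>b\<in>Basis. g b *\<^sub>R b) \<in> measurable (\<Pi>\<^sub>M b\<in>(Basis::'b set). lborel) borel"
    by measurable
  have coord: "(\<Prod>b\<in>Basis. f b ((\<Sum>c\<in>Basis. g c *\<^sub>R c) \<bullet> b)) = (\<Prod>b\<in>Basis. f b (g b))"
    for g :: "'b \<Rightarrow> real"
    by (intro prod.cong refl) simp
  have "has_bochner_integral (\<Pi>\<^sub>M b\<in>(Basis::'b set). lborel)
          (\<lambda>g. \<Prod>b\<in>Basis. f b (g b)) (\<Prod>b\<in>Basis. integral\<^sup>L lborel (f b))"
    by (simp add: has_bochner_integral_iff product_integrable_prod product_integral_prod f)
  then show ?thesis
    using has_bochner_integral_distr[OF m m', of "\<Prod>b\<in>Basis. integral\<^sup>L lborel (f b)"]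
    unfolding coord lborel_eq[where 'a='b, symmetric] by blast
qed

text \<open>The density of the standard Gaussian vector, as a product of one-dimensional densities along
  the canonical orthonormal basis. It is defined on the Euclidean space itself, so that the
  translation invariance of Lebesgue measure can be used directly.\<close>

definition gauss_density :: "'b::euclidean_space \<Rightarrow> real" where
  "gauss_density y = (\<Prod>b\<in>Basis. std_normal_density (y \<bullet> b))"

text \<open>The standard Gaussian measure, with mean 0 and identity covariance.\<close>

definition std_gauss :: "'b::euclidean_space measure" where
  "std_gauss = density lborel (\<lambda>y. ennreal (gauss_density y))"

lemma gauss_density_nonneg [simp]: "0 \<le> gauss_density y"
  by (simp add: gauss_density_def prod_nonneg)

lemma borel_measurable_gauss_density [measurable]: "gauss_density \<in> borel_measurable borel"
  unfolding gauss_density_def by measurable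

lemma sets_std_gauss [measurable_cong, simp]: "sets std_gauss = sets borel"
  by (simp add: std_gauss_def)

lemma space_std_gauss [simp]: "space std_gauss = UNIV"
  by (simp add: std_gauss_def)

lemma gauss_density_eq_exp_norm:
  "gauss_density (y::'b::euclidean_space) = (1 / sqrt (2 * pi)) ^ DIM('b) * exp (- (norm y)\<^sup>2 / 2)"
proof -
  have "(norm y)\<^sup>2 = (\<Sum>b\<in>Basis. (y \<bullet> b)\<^sup>2)"
    by (subst power2_norm_eq_inner, subst euclidean_inner) (simp add: power2_eq_square)
  then have "exp (- (norm y)\<^sup>2 / 2) = (\<Prod>b\<in>Basis. exp (- (y \<bullet> b)\<^sup>2 / 2))"
    by (simp add: exp_sum[symmetric] sum_negf sum_divide_distrib)
  then show ?thesis
    by (simp add: gauss_density_def std_normal_density_def prod_dividef power_one_over)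
qed

lemma gauss_density_uminus [simp]: "gauss_density (- y) = gauss_density y"
  by (simp add: gauss_density_eq_exp_norm)

lemma gauss_density_add:
  "gauss_density (v + y) = exp (- (v \<bullet> y) - (norm v)\<^sup>2 / 2) * gauss_density y"
proof -
  have "- (norm (v + y))\<^sup>2 / 2 = (- (v \<bullet> y) - (norm v)\<^sup>2 / 2) + (- (norm y)\<^sup>2 / 2)"
    by (simp add: power2_norm_eq_inner inner_add inner_commute field_simps)
  then show ?thesis
    by (simp only: gauss_density_eq_exp_norm exp_add mult_ac)
qed

lemma nn_integral_std_gauss:
  "f \<in> borel_measurable borel \<Longrightarrow>
   (\<integral>\<^sup>+ y. f y \<partial>std_gauss) = (\<integral>\<^sup>+ y. ennreal (gauss_density y) * f y \<partial>lborel)"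
  by (simp add: std_gauss_def nn_integral_density)

lemma prob_space_std_gauss: "prob_space (std_gauss :: 'b::euclidean_space measure)"
proof
  have 1: "(\<integral>\<^sup>+ x. ennreal (std_normal_density x) \<partial>lborel) = 1"
    using prob_space.emeasure_space_1[OF prob_space_normal_density[of 1 0]]
    by (simp add: emeasure_density)
  have "emeasure (std_gauss :: 'b measure) (space std_gauss)
      = (\<integral>\<^sup>+ y. (\<Prod>b\<in>Basis. ennreal (std_normal_density (y \<bullet> b))) \<partial>(lborel::'b measure))"
    by (simp add: std_gauss_def emeasure_density gauss_density_def prod_ennreal)
  also have "\<dots> = 1"
    by (subst nn_integral_lborel_prod) (simp_all add: 1)
  finally show "emeasure (std_gauss :: 'b measure) (space std_gauss) = 1" .
qed

lemma has_bochner_integral_std_gauss_coords: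
  assumes i: "i \<in> Basis" and j: "j \<in> Basis"
  shows "has_bochner_integral std_gauss (\<lambda>y::'b::euclidean_space. (y \<bullet> i) * (y \<bullet> j))
           (if i = j then 1 else 0)"
proof -
  \<comment> \<open>Each coordinate contributes the moment of order 0, 1 or 2, according to how many of
      \<open>i\<close> and \<open>j\<close> it equals.\<close>
  define f :: "'b \<Rightarrow> real \<Rightarrow> real" where
    "f b x = std_normal_density x *
       x ^ ((if b = i then 1 else 0) + (if b = j then 1 else 0))" for b x
  have int: "integrable lborel (f b)" for b
    unfolding f_def by (rule integrable_std_normal_moment)
  have m0: "integral\<^sup>L lborel std_normal_density = 1"
    using integral_std_normal_moment_even[of 0] by simp
  have m1: "(LBINT x. std_normal_density x * x) = 0"
    using integral_std_normal_moment_odd[of 0] by simp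
  have m2: "(LBINT x. std_normal_density x * x\<^sup>2) = 1"
    using integral_std_normal_moment_even[of 1] by simp
  have prod: "(\<Prod>b\<in>Basis. integral\<^sup>L lborel (f b)) = (if i = j then 1 else 0)"
  proof (cases "i = j")
    case True
    have "integral\<^sup>L lborel (f b) = 1" for b
      using True by (cases "b = j") (simp_all add: f_def[abs_def] m0 m2 numeral_2_eq_2[symmetric] del: One_nat_def)
    then show ?thesis
      using True by simp
  next
    case False
    then have "integral\<^sup>L lborel (f i) = 0"
      by (simp add: f_def[abs_def] m1)
    then show ?thesis
      using False i by (simp add: prod_zero_iff) blast
  qed
  have eq: "(\<Prod>b\<in>Basis. f b (y \<bullet> b)) = gauss_density y * ((y \<bullet> i) * (y \<bullet> j))" for y
  proof -
    have "(\<Prod>b\<in>Basis. f b (y \<bullet> b)) = gauss_density y *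
       ((\<Prod>b\<in>Basis. (y \<bullet> b) ^ (if b = i then 1 else 0)) *
        (\<Prod>b\<in>Basis. (y \<bullet> b) ^ (if b = j then 1 else 0)))"
      by (simp only: f_def gauss_density_def prod.distrib power_add)
    moreover have "(\<Prod>b\<in>Basis. (y \<bullet> b) ^ (if b = k then 1 else 0)) = y \<bullet> k"
      if "k \<in> Basis" for k
    proof -
      have "(\<Prod>b\<in>Basis. (y \<bullet> b) ^ (if b = k then 1 else 0))
          = (\<Prod>b\<in>Basis. if b = k then y \<bullet> b else 1)"
        by (intro prod.cong) auto
      then show ?thesis
        using that by simp
    qed
    ultimately show ?thesis
      using i j by simp
  qed
  have "has_bochner_integral lborel (\<lambda>y::'b. gauss_density y *\<^sub>R ((y \<bullet> i) * (y \<bullet> j)))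
           (if i = j then 1 else 0)"
    using has_bochner_integral_lborel_prod[of f, OF int] unfolding prod eq by simp
  then show ?thesis
    unfolding std_gauss_def by (intro has_bochner_integral_density) auto
qed

lemma nn_integral_lborel_translate:
  fixes v :: "'b::euclidean_space"
  assumes [measurable]: "f \<in> borel_measurable borel"
  shows "(\<integral>\<^sup>+ y. f y \<partial>lborel) = (\<integral>\<^sup>+ y. f (v + y) \<partial>lborel)"
  by (subst lborel_affine[of 1 v]) (simp_all add: nn_integral_density nn_integral_distr)

lemma nn_integral_lborel_uminus:
  fixes f :: "'b::euclidean_space \<Rightarrow> ennreal"
  assumes [measurable]: "f \<in> borel_measurable borel"
  shows "(\<integral>\<^sup>+ y. f y \<partial>lborel) = (\<integral>\<^sup>+ y. f (- y) \<partial>lborel)"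
  by (subst lborel_affine[of "-1" 0]) (simp_all add: nn_integral_density nn_integral_distr)

lemma nn_integral_std_gauss_uminus:
  fixes f :: "'b::euclidean_space \<Rightarrow> ennreal"
  assumes [measurable]: "f \<in> borel_measurable borel"
  shows "(\<integral>\<^sup>+ y. f y \<partial>std_gauss) = (\<integral>\<^sup>+ y. f (- y) \<partial>std_gauss)"
  using nn_integral_lborel_uminus[of "\<lambda>y. ennreal (gauss_density y) * f y"]
  by (simp add: nn_integral_std_gauss)

text \<open>The Cameron--Martin formula for translations in finite dimension.\<close>

lemma nn_integral_std_gauss_translate:
  fixes f :: "'b::euclidean_space \<Rightarrow> ennreal"
  assumes [measurable]: "f \<in> borel_measurable borel"
  shows "(\<integral>\<^sup>+ y. f y \<partial>std_gauss)
       = (\<integral>\<^sup>+ y. ennreal (exp (- (v \<bullet> y) - (norm v)\<^sup>2 / 2)) * f (v + y) \<partial>std_gauss)"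
  using nn_integral_lborel_translate[of "\<lambda>y. ennreal (gauss_density y) * f y" v]
  by (simp add: nn_integral_std_gauss gauss_density_add ennreal_mult mult_ac)

text \<open>Averaging the integrand at \<open>y\<close> and at \<open>-y\<close> turns the exponential into a hyperbolic cosine,
  which is at least 1.\<close>

lemma emeasure_std_gauss_le_exp_linear:
  fixes w :: "'b::euclidean_space"
  assumes [measurable]: "G \<in> sets borel" and sym: "\<And>y. - y \<in> G \<longleftrightarrow> y \<in> G"
  shows "emeasure std_gauss G \<le> (\<integral>\<^sup>+ y. ennreal (exp (w \<bullet> y)) * indicator G y \<partial>std_gauss)"
    (is "_ \<le> ?I")
proof -
  have cosh: "1 \<le> ennreal (1/2) * (ennreal (exp r) + ennreal (exp (- r)))" for r :: real
  proof -
    have "1 \<le> (1/2) * (exp r + exp (- r))"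
      using cosh_real_ge_1[of r] by (simp add: cosh_field_def)
    then show ?thesis
      by (simp only: ennreal_plus[symmetric] ennreal_mult[symmetric] exp_ge_zero add_nonneg_nonneg
          ennreal_1[symmetric] ennreal_leI)
  qed
  have I_minus: "?I = (\<integral>\<^sup>+ y. ennreal (exp (- (w \<bullet> y))) * indicator G y \<partial>std_gauss)"
    by (subst nn_integral_std_gauss_uminus) (simp_all add: indicator_def sym)
  have "emeasure std_gauss G = (\<integral>\<^sup>+ y. indicator G y \<partial>std_gauss)"
    by simp
  also have "\<dots> \<le> (\<integral>\<^sup>+ y. ennreal (1/2) * (ennreal (exp (w \<bullet> y)) * indicator G y
                        + ennreal (exp (- (w \<bullet> y))) * indicator G y) \<partial>std_gauss)"
    using cosh by (intro nn_integral_mono) (auto simp: indicator_def)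
  also have "\<dots> = ennreal (1/2) * (?I + ?I)"
    by (subst nn_integral_cmult, measurable, subst nn_integral_add, measurable)
      (simp add: I_minus)
  also have "\<dots> = ?I"
  proof -
    have "ennreal (1/2) * 2 = ennreal (1/2) * ennreal 2" by simp
    also have "\<dots> = 1" by (subst ennreal_mult[symmetric]) simp_all
    finally have half: "ennreal (1/2) * 2 = 1" .
    have "ennreal (1/2) * (?I + ?I) = (ennreal (1/2) * 2) * ?I"
      by (simp only: mult_2[symmetric] mult.assoc)
    then show ?thesis by (simp only: half mult_1_left)
  qed
  finally show ?thesis .
qed

text \<open>A lower bound for a Gaussian exponential integral that keeps only the translate \<open>v + G\<close> of a
  symmetric set. The linear term produced by the translation and the one in the integrand merge into
  a single linear functional, and the previous lemma discards it.\<close>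

lemma exp_shift_le_nn_integral_std_gauss:
  fixes x v :: "'b::euclidean_space"
  assumes [measurable]: "A \<in> sets borel" "G \<in> sets borel"
    and sym: "\<And>y. - y \<in> G \<longleftrightarrow> y \<in> G" and shift: "\<And>y. y \<in> G \<Longrightarrow> v + y \<in> A"
  shows "ennreal (exp (x \<bullet> v - (norm v)\<^sup>2 / 2)) * emeasure std_gauss G
       \<le> (\<integral>\<^sup>+ y. ennreal (exp (x \<bullet> y)) * indicator A y \<partial>std_gauss)"
proof -
  have "ennreal (exp (x \<bullet> v - (norm v)\<^sup>2 / 2)) * emeasure std_gauss G
     \<le> ennreal (exp (x \<bullet> v - (norm v)\<^sup>2 / 2)) *
         (\<integral>\<^sup>+ y. ennreal (exp ((x - v) \<bullet> y)) * indicator G y \<partial>std_gauss)"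
    using sym by (intro mult_left_mono emeasure_std_gauss_le_exp_linear) auto
  also have "\<dots> = (\<integral>\<^sup>+ y. ennreal (exp (- (v \<bullet> y) - (norm v)\<^sup>2 / 2)) *
                    (ennreal (exp (x \<bullet> (v + y))) * indicator G y) \<partial>std_gauss)"
    by (subst nn_integral_cmult[symmetric], measurable, intro nn_integral_cong)
      (simp add: mult.assoc[symmetric] ennreal_mult[symmetric] exp_add[symmetric]
        inner_add inner_diff algebra_simps)
  also have "\<dots> \<le> (\<integral>\<^sup>+ y. ennreal (exp (- (v \<bullet> y) - (norm v)\<^sup>2 / 2)) *
                    (ennreal (exp (x \<bullet> (v + y))) * indicator A (v + y)) \<partial>std_gauss)"
    using shift by (intro nn_integral_mono mult_left_mono) (auto simp: indicator_def)
  also have "\<dots> = (\<integral>\<^sup>+ y. ennreal (exp (x \<bullet> y)) * indicator A y \<partial>std_gauss)"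
    by (subst nn_integral_std_gauss_translate[of _ v]) simp_all
  finally show ?thesis .
qed

section \<open>Quadratic forms\<close>

lemma quadratic_form_eq_sum:
  fixes S :: "real ^ 'd ^ 'd"
  shows "y \<bullet> (S *v y) = (\<Sum>i\<in>UNIV. \<Sum>j\<in>UNIV. S $ i $ j * (y $ i * y $ j))"
  by (simp add: inner_vec_def matrix_vector_mult_def sum_distrib_left mult_ac)

lemma has_bochner_integral_quadratic_form_std_gauss:
  fixes S :: "real ^ 'd ^ 'd"
  shows "has_bochner_integral std_gauss (\<lambda>y. y \<bullet> (S *v y)) (trace S)"
proof -
  have "has_bochner_integral std_gauss (\<lambda>y::real^'d. y $ i * y $ j) (if i = j then 1 else 0)"
    for i j :: 'd
    using has_bochner_integral_std_gauss_coords[of "axis i 1 :: real^'d" "axis j 1"]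
    by (simp add: inner_axis axis_eq_axis)
  then have "has_bochner_integral std_gauss
      (\<lambda>y. \<Sum>i\<in>UNIV. \<Sum>j\<in>UNIV. S $ i $ j * (y $ i * y $ j))
      (\<Sum>i\<in>UNIV. \<Sum>j\<in>UNIV. S $ i $ j * (if i = j then 1 else 0))"
    by (intro has_bochner_integral_sum has_bochner_integral_mult_right)
  then show ?thesis
    by (simp add: quadratic_form_eq_sum trace_def if_distrib cong: if_cong)
qed

lemma std_gauss_quadratic_form_ge_half:
  fixes S :: "real ^ 'd ^ 'd"
  assumes psd: "\<And>y. 0 \<le> y \<bullet> (S *v y)" and T: "0 < trace S"
  shows "1/2 \<le> measure std_gauss {y. y \<bullet> (S *v y) < 2 * trace S}"
proof -
  interpret prob_space "std_gauss :: (real^'d) measure" by (rule prob_space_std_gauss)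
  note hb = has_bochner_integral_quadratic_form_std_gauss[of S]
  \<comment> \<open>Markov's inequality; the set parameter of the library lemma plays no role here.\<close>
  have "measure std_gauss {y \<in> space std_gauss. 2 * trace S \<le> y \<bullet> (S *v y)}
      \<le> (\<integral>y. y \<bullet> (S *v y) \<partial>std_gauss) / (2 * trace S)"
    using hb psd T
    by (intro integral_Markov_inequality_measure[where A="{}"]) (auto simp: has_bochner_integral_iff)
  also have "\<dots> = 1/2"
    using has_bochner_integral_integral_eq[OF hb] T by simp
  finally have le: "measure std_gauss {y. 2 * trace S \<le> y \<bullet> (S *v y)} \<le> 1/2"
    by simp
  have [measurable]: "(\<lambda>y. y \<bullet> (S *v y)) \<in> borel_measurable borel"
    unfolding quadratic_form_eq_sum by measurable
  have "measure std_gauss {y. y \<bullet> (S *v y) < 2 * trace S}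
      = 1 - measure std_gauss {y. 2 * trace S \<le> y \<bullet> (S *v y)}"
    by (subst prob_compl[symmetric]) (auto intro!: arg_cong[where f="measure std_gauss"])
  with le show ?thesis by simp
qed

text \<open>This follows from the parallelogram identity, which does not need \<open>S\<close> to be symmetric.\<close>

lemma quadratic_form_add_le:
  fixes S :: "real ^ 'd ^ 'd"
  assumes "\<And>y. 0 \<le> y \<bullet> (S *v y)"
  shows "(v + y) \<bullet> (S *v (v + y)) \<le> 2 * (v \<bullet> (S *v v)) + 2 * (y \<bullet> (S *v y))"
proof -
  have "(v + y) \<bullet> (S *v (v + y)) + (v - y) \<bullet> (S *v (v - y))
      = 2 * (v \<bullet> (S *v v)) + 2 * (y \<bullet> (S *v y))"
    by (simp add: matrix_vector_right_distrib matrix_vector_mult_diff_distrib inner_add inner_diff)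
  with assms[of "v - y"] show ?thesis by linarith
qed

lemma quadratic_form_le_onorm:
  fixes S :: "real ^ 'd ^ 'd"
  shows "v \<bullet> (S *v v) \<le> onorm ((*v) S) * (norm v)\<^sup>2"
proof -
  have "v \<bullet> (S *v v) \<le> norm v * norm (S *v v)"
    by (rule norm_cauchy_schwarz)
  also have "\<dots> \<le> norm v * (onorm ((*v) S) * norm v)"
    by (intro mult_left_mono onorm) (auto simp: matrix_vector_mul_bounded_linear)
  finally show ?thesis by (simp add: power2_eq_square mult_ac)
qed

section \<open>Second moments and the Orlicz norm\<close>

lemma outer_prod_nth: "outer_prod x $ i $ j = x $ i * x $ j"
  by (simp add: outer_prod_def matrix_matrix_mult_def columnvector_def rowvector_def)

lemma second_moment_matrix:
  fixes X :: "'a \<Rightarrow> real ^ 'd"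
  assumes "integrable M (\<lambda>\<omega>. outer_prod (X \<omega>))"
  defines "S \<equiv> (LINT \<omega>|M. outer_prod (X \<omega>))"
  shows "has_bochner_integral M (\<lambda>\<omega>. (X \<omega> \<bullet> y)\<^sup>2) (y \<bullet> (S *v y))"
    and "has_bochner_integral M (\<lambda>\<omega>. (norm (X \<omega>))\<^sup>2) (trace S)"
proof -
  have hb: "has_bochner_integral M (\<lambda>\<omega>. outer_prod (X \<omega>)) S"
    using assms by (simp add: has_bochner_integral_iff)
  have lin: "bounded_linear (\<lambda>A::real^'d^'d. A $ i $ j)" for i j
    using bounded_linear_compose[OF bounded_linear_vec_nth bounded_linear_vec_nth] .
  have ent: "has_bochner_integral M (\<lambda>\<omega>. X \<omega> $ i * X \<omega> $ j) (S $ i $ j)" for i j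
    using has_bochner_integral_bounded_linear[OF lin hb, of i j] by (simp add: outer_prod_nth)
  have "has_bochner_integral M
      (\<lambda>\<omega>. \<Sum>i\<in>UNIV. \<Sum>j\<in>UNIV. (X \<omega> $ i * X \<omega> $ j) * (y $ i * y $ j))
      (\<Sum>i\<in>UNIV. \<Sum>j\<in>UNIV. S $ i $ j * (y $ i * y $ j))"
    by (intro has_bochner_integral_sum has_bochner_integral_mult_left ent)
  then show "has_bochner_integral M (\<lambda>\<omega>. (X \<omega> \<bullet> y)\<^sup>2) (y \<bullet> (S *v y))"
    by (simp add: quadratic_form_eq_sum[of y S] inner_vec_def[of "X _"] power2_eq_square
        sum_product mult_ac)
  have "has_bochner_integral M (\<lambda>\<omega>. \<Sum>i\<in>UNIV. X \<omega> $ i * X \<omega> $ i) (\<Sum>i\<in>UNIV. S $ i $ i)"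
    by (intro has_bochner_integral_sum ent)
  then show "has_bochner_integral M (\<lambda>\<omega>. (norm (X \<omega>))\<^sup>2) (trace S)"
    by (simp add: power2_norm_eq_inner inner_vec_def trace_def)
qed

text \<open>The strict inequality supplies an admissible constant below \<open>c\<close>, so that the infimum in the
  definition of the norm need not be attained.\<close>

lemma nn_integral_exp_le_2_if_psi_norm_less:
  assumes less: "psi_norm M 1 Y < ennreal c"
  shows "(\<integral>\<^sup>+ \<omega>. ennreal (exp (\<bar>Y \<omega>\<bar> / c)) \<partial>M) \<le> 2"
proof -
  obtain c' where c': "0 < c'" "ennreal c' < ennreal c"
    "(\<integral>\<^sup>+ \<omega>. ennreal (exp (\<bar>Y \<omega>\<bar> powr 1 / c' powr 1)) \<partial>M) \<le> 2"
    using less unfolding psi_norm_def Inf_less_iff by auto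
  then have "c' < c" by (simp add: ennreal_less_iff)
  have "(\<integral>\<^sup>+ \<omega>. ennreal (exp (\<bar>Y \<omega>\<bar> / c)) \<partial>M)
      \<le> (\<integral>\<^sup>+ \<omega>. ennreal (exp (\<bar>Y \<omega>\<bar> powr 1 / c' powr 1)) \<partial>M)"
    using c' \<open>c' < c\<close> by (intro nn_integral_mono ennreal_leI) (auto intro!: divide_left_mono)
  also note c'(3)
  finally show ?thesis .
qed

section \<open>The tail bound\<close>

text \<open>The deterministic half of the argument: the exponential integral over the ellipsoid sees the
  full length of \<open>x\<close>, for every direction of \<open>x\<close> at once.\<close>

lemma exp_norm_le_nn_integral_std_gauss:
  fixes S :: "real ^ 'd ^ 'd" and x :: "real ^ 'd"
  assumes psd: "\<And>y. 0 \<le> y \<bullet> (S *v y)" and T: "0 < trace S"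
    and s: "0 \<le> s" and x: "x \<noteq> 0"
    and R: "2 * s\<^sup>2 * onorm ((*v) S) + 4 * trace S \<le> R"
  shows "ennreal (exp (s * norm x - s\<^sup>2 / 2) / 2)
       \<le> (\<integral>\<^sup>+ y. ennreal (exp (x \<bullet> y)) * indicator {y. y \<bullet> (S *v y) < R} y \<partial>std_gauss)"
proof -
  interpret prob_space "std_gauss :: (real^'d) measure" by (rule prob_space_std_gauss)
  define v where "v = (s / norm x) *\<^sub>R x"
  define G where "G = {y. y \<bullet> (S *v y) < 2 * trace S}"
  have [measurable]: "(\<lambda>y. y \<bullet> (S *v y)) \<in> borel_measurable borel"
    unfolding quadratic_form_eq_sum by measurable
  have [measurable]: "G \<in> sets borel"
    unfolding G_def by measurable
  have norm_v: "norm v = s" and x_v: "x \<bullet> v = s * norm x"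
    using s x by (simp_all add: v_def power2_norm_eq_inner[symmetric] power2_eq_square)
  have sym: "- y \<in> G \<longleftrightarrow> y \<in> G" for y
    using matrix_vector_mult_diff_distrib[of S 0 y] by (simp add: G_def)
  have shift: "(v + y) \<bullet> (S *v (v + y)) < R" if "y \<in> G" for y
  proof -
    have "(v + y) \<bullet> (S *v (v + y)) \<le> 2 * (v \<bullet> (S *v v)) + 2 * (y \<bullet> (S *v y))"
      using psd by (rule quadratic_form_add_le)
    moreover have "v \<bullet> (S *v v) \<le> s\<^sup>2 * onorm ((*v) S)"
      using quadratic_form_le_onorm[of v S] by (simp add: norm_v mult_ac)
    ultimately show ?thesis
      using that R by (simp add: G_def)
  qed
  have "ennreal (1/2) \<le> emeasure std_gauss G"
    unfolding emeasure_eq_measure G_def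
    by (intro ennreal_leI std_gauss_quadratic_form_ge_half psd T)
  then have "ennreal (exp (s * norm x - s\<^sup>2 / 2)) * ennreal (1/2)
      \<le> ennreal (exp (s * norm x - s\<^sup>2 / 2)) * emeasure std_gauss G"
    by (intro mult_left_mono) auto
  also have "\<dots> \<le> (\<integral>\<^sup>+ y. ennreal (exp (x \<bullet> y)) * indicator {y. y \<bullet> (S *v y) < R} y \<partial>std_gauss)"
    using exp_shift_le_nn_integral_std_gauss[of "{y. y \<bullet> (S *v y) < R}" G v x] sym shift
    by (simp add: norm_v x_v)
  finally show ?thesis
    by (subst (asm) ennreal_mult[symmetric]) simp_all
qed

text \<open>The probabilistic half, with the parameter \<open>s\<close> and the scale \<open>c\<close> left free. The matrix \<open>S\<close>
  enters only through the ellipsoid on which the exponential moments are controlled; it need not be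
  the covariance of \<open>X\<close>.\<close>

lemma prob_norm_gt_le:
  fixes M :: "'a measure" and X :: "'a \<Rightarrow> real ^ 'd" and S :: "real ^ 'd ^ 'd"
  assumes "prob_space M" and [measurable]: "X \<in> borel_measurable M"
    and psd: "\<And>y. 0 \<le> y \<bullet> (S *v y)" and T: "0 < trace S"
    and c: "0 < c" and s: "0 \<le> s" and b: "0 \<le> b"
    and R: "2 * s\<^sup>2 * onorm ((*v) S) + 4 * trace S \<le> R"
    and mgf: "\<And>y. y \<bullet> (S *v y) < R \<Longrightarrow>
                (\<integral>\<^sup>+ \<omega>. ennreal (exp (\<bar>X \<omega> \<bullet> y\<bar> / c)) \<partial>M) \<le> 2"
  shows "measure M {\<omega> \<in> space M. b < norm (X \<omega>)} \<le> 4 * exp (s\<^sup>2 / 2 - s * b / c)"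
proof -
  interpret prob_space M by fact
  interpret gauss: prob_space "std_gauss :: (real^'d) measure" by (rule prob_space_std_gauss)
  interpret pair_sigma_finite M "std_gauss :: (real^'d) measure" ..
  have [measurable]: "(\<lambda>y. y \<bullet> (S *v y)) \<in> borel_measurable borel"
    unfolding quadratic_form_eq_sum by measurable
  define A where "A = {y. y \<bullet> (S *v y) < R}"
  have [measurable]: "A \<in> sets borel"
    unfolding A_def by measurable
  define H where "H \<omega> = (\<integral>\<^sup>+ y. ennreal (exp (\<bar>X \<omega> \<bullet> y\<bar> / c)) * indicator A y \<partial>std_gauss)" for \<omega>
  define B where "B = {\<omega> \<in> space M. b < norm (X \<omega>)}"
  define h where "h = exp (s * b / c - s\<^sup>2 / 2) / 2"
  have B [measurable]: "B \<in> sets M"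
    unfolding B_def by measurable
  have low: "ennreal h \<le> H \<omega>" if "\<omega> \<in> B" for \<omega>
  proof -
    have less: "b < norm (X \<omega>)" using that by (simp add: B_def)
    define x where "x = (1 / c) *\<^sub>R X \<omega>"
    have x: "x \<noteq> 0" "norm x = norm (X \<omega>) / c"
      using less b c by (auto simp: x_def)
    have "s * b / c \<le> s * norm x"
      using less s c by (simp add: x divide_right_mono mult_left_mono)
    then have "ennreal h \<le> ennreal (exp (s * norm x - s\<^sup>2 / 2) / 2)"
      by (simp add: h_def ennreal_leI)
    also have "\<dots> \<le> (\<integral>\<^sup>+ y. ennreal (exp (x \<bullet> y)) * indicator A y \<partial>std_gauss)"
      unfolding A_def by (rule exp_norm_le_nn_integral_std_gauss[OF psd T s x(1) R])
    also have "\<dots> \<le> H \<omega>"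
      unfolding H_def using c
      by (intro nn_integral_mono mult_right_mono ennreal_leI) (auto simp: x_def divide_right_mono)
    finally show ?thesis .
  qed
  \<comment> \<open>Markov's inequality for \<open>H\<close>, whose expectation is computed by exchanging the integrals.\<close>
  have "ennreal h * emeasure M B = (\<integral>\<^sup>+ \<omega>. ennreal h * indicator B \<omega> \<partial>M)"
    using B by (simp add: nn_integral_cmult_indicator)
  also have "\<dots> \<le> (\<integral>\<^sup>+ \<omega>. H \<omega> \<partial>M)"
    using low by (intro nn_integral_mono) (auto simp: indicator_def)
  also have "\<dots> = (\<integral>\<^sup>+ y. (\<integral>\<^sup>+ \<omega>. ennreal (exp (\<bar>X \<omega> \<bullet> y\<bar> / c)) * indicator A y \<partial>M) \<partial>std_gauss)"
    unfolding H_def by (rule Fubini'[symmetric]) measurable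
  also have "\<dots> \<le> (\<integral>\<^sup>+ (y::real^'d). 2 \<partial>std_gauss)"
    using mgf by (intro nn_integral_mono) (auto simp: indicator_def A_def)
  also have "\<dots> = 2"
    using gauss.emeasure_space_1 by simp
  finally have "ennreal (h * measure M B) \<le> ennreal 2"
    by (subst ennreal_mult) (simp_all add: emeasure_eq_measure h_def)
  then have "h * measure M B \<le> 2"
    by (subst (asm) ennreal_le_iff) simp_all
  then have "measure M B \<le> 2 / h"
    by (simp add: h_def field_simps)
  also have "2 / h = 4 * exp (s\<^sup>2 / 2 - s * b / c)"
    by (simp add: h_def exp_diff)
  finally show ?thesis by (simp add: B_def)
qed

theorem proposition3:
  fixes M :: "'a measure"
    and X :: "'a \<Rightarrow> real ^ 'd"
    and \<Sigma> :: "real ^ 'd ^ 'd"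
    and \<kappa> t :: real
  assumes "prob_space M"
    and "X \<in> borel_measurable M"
    and "integrable M X"
    and "(LINT \<omega>|M. X \<omega>) = 0"
    and "integrable M (\<lambda>\<omega>. outer_prod (X \<omega>))"
    and "\<Sigma> = (LINT \<omega>|M. outer_prod (X \<omega>))"
    and "\<kappa> > 0"
    and "\<And>y :: real ^ 'd.
           psi_norm M 1 (\<lambda>\<omega>. X \<omega> \<bullet> y) \<le> ennreal (\<kappa> * sqrt (y \<bullet> (\<Sigma> *v y)))"
    and "t \<ge> 1"
  shows "measure M {\<omega> \<in> space M.
           norm (X \<omega>) \<le> 8 * \<kappa> * (sqrt (t * trace \<Sigma>) + t * sqrt (onorm ((*v) \<Sigma>)))}
         \<ge> 1 - exp (- t)"
proof -
  interpret prob_space M by fact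
  note [measurable] = \<open>X \<in> borel_measurable M\<close>
  define T where "T = trace \<Sigma>"
  define L where "L = onorm ((*v) \<Sigma>)"
  define m where "m = sqrt (t * T) + t * sqrt L"
  define b where "b = 8 * \<kappa> * m"
  note mom = second_moment_matrix[OF assms(5), folded assms(6)]
  have psd: "0 \<le> y \<bullet> (\<Sigma> *v y)" for y
    unfolding has_bochner_integral_integral_eq[OF mom(1)[of y], symmetric]
    by (rule Bochner_Integration.integral_nonneg) simp
  have "0 \<le> T"
    unfolding T_def has_bochner_integral_integral_eq[OF mom(2), symmetric]
    by (rule Bochner_Integration.integral_nonneg) simp
  have "0 \<le> L"
    unfolding L_def by (intro onorm_pos_le matrix_vector_mul_bounded_linear)
  have "0 \<le> m" "0 \<le> b"
    using \<open>0 \<le> T\<close> \<open>0 \<le> L\<close> assms(7,9) by (simp_all add: m_def b_def)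
  have "measure M {\<omega> \<in> space M. b < norm (X \<omega>)} \<le> exp (- t)"
  proof (cases "T = 0")
    case True
    have "AE \<omega> in M. (norm (X \<omega>))\<^sup>2 = 0"
      using mom(2) True
      by (subst integral_nonneg_eq_0_iff_AE[symmetric]) (auto simp: has_bochner_integral_iff T_def)
    then have "measure M {\<omega> \<in> space M. b < norm (X \<omega>)} = 0"
      using \<open>0 \<le> b\<close> by (subst prob_eq_0) auto
    then show ?thesis by simp
  next
    case False
    with \<open>0 \<le> T\<close> have "0 < T" by simp
    \<comment> \<open>Doubling the value \<open>4 (t L + T)\<close> that \<open>s\<^sup>2 = 2t\<close> requires keeps the estimates below free of
        square roots of 2.\<close>
    define R where "R = 8 * (t * L + T)"
    have "0 < R"
      using \<open>0 < T\<close> \<open>0 \<le> L\<close> assms(9) by (simp add: R_def add_nonneg_pos)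
    have "0 < \<kappa> * sqrt R" using \<open>0 < R\<close> assms(7) by simp
    have mgf: "(\<integral>\<^sup>+ \<omega>. ennreal (exp (\<bar>X \<omega> \<bullet> y\<bar> / (\<kappa> * sqrt R))) \<partial>M) \<le> 2"
      if "y \<bullet> (\<Sigma> *v y) < R" for y
    proof (rule nn_integral_exp_le_2_if_psi_norm_less)
      have "ennreal (\<kappa> * sqrt (y \<bullet> (\<Sigma> *v y))) < ennreal (\<kappa> * sqrt R)"
        using that psd[of y] assms(7) by (intro ennreal_lessI) auto
      then show "psi_norm M 1 (\<lambda>\<omega>. X \<omega> \<bullet> y) < ennreal (\<kappa> * sqrt R)"
        using assms(8)[of y] by (rule le_less_trans[rotated])
    qed
    have s2: "(sqrt (2 * t))\<^sup>2 = 2 * t" using assms(9) by simp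
    have "measure M {\<omega> \<in> space M. b < norm (X \<omega>)}
        \<le> 4 * exp ((sqrt (2 * t))\<^sup>2 / 2 - sqrt (2 * t) * b / (\<kappa> * sqrt R))"
    proof (rule prob_norm_gt_le[where S=\<Sigma> and R=R])
      show "2 * (sqrt (2 * t))\<^sup>2 * onorm ((*v) \<Sigma>) + 4 * trace \<Sigma> \<le> R"
        using \<open>0 \<le> T\<close> \<open>0 \<le> L\<close> assms(9)
        by (simp add: s2 R_def flip: L_def T_def)
      show "0 < trace \<Sigma>" using \<open>0 < T\<close> by (simp add: T_def)
      show "0 \<le> sqrt (2 * t)" using assms(9) by simp
    qed (fact assms(1,2) psd \<open>0 \<le> b\<close> \<open>0 < \<kappa> * sqrt R\<close> mgf)+
    also have "\<dots> \<le> 4 * exp (- (3 * t))"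
    proof -
      have "t * R = 8 * ((t * sqrt L)\<^sup>2 + (sqrt (t * T))\<^sup>2)"
        using \<open>0 \<le> T\<close> \<open>0 \<le> L\<close> assms(9)
        by (simp add: R_def power_mult_distrib power2_eq_square algebra_simps)
      also have "\<dots> \<le> 8 * m\<^sup>2"
        using \<open>0 \<le> T\<close> \<open>0 \<le> L\<close> assms(9) by (simp add: m_def power2_sum)
      finally have "t * R \<le> 8 * m\<^sup>2" .
      then have "2 * t * R \<le> (4 * m)\<^sup>2"
        by (simp add: power_mult_distrib mult.commute)
      then have "sqrt (2 * t * R) \<le> sqrt ((4 * m)\<^sup>2)"
        by (rule real_sqrt_le_mono)
      then have "sqrt (2 * t) * sqrt R \<le> 4 * m"
        using \<open>0 \<le> m\<close> by (simp add: real_sqrt_mult)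
      then have "(sqrt (2 * t) * sqrt R) * (4 * sqrt (2 * t)) \<le> (4 * m) * (4 * sqrt (2 * t))"
        using assms(9) by (intro mult_right_mono) auto
      then have "4 * ((sqrt (2 * t))\<^sup>2) * sqrt R \<le> 16 * m * sqrt (2 * t)"
        by (simp add: power2_eq_square mult_ac)
      then have "4 * t * sqrt R \<le> 8 * m * sqrt (2 * t)"
        unfolding s2 by simp
      then have "4 * t \<le> sqrt (2 * t) * b / (\<kappa> * sqrt R)"
        using \<open>0 < R\<close> assms(7) by (simp add: b_def field_simps)
      then show ?thesis by (simp add: s2)
    qed
    also have "\<dots> \<le> exp (- t)"
    proof -
      have "2 \<le> exp t"
        using exp_ge_add_one_self[of t] assms(9) by linarith
      then have "2 * 2 \<le> exp t * exp t"
        by (intro mult_mono) auto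
      then have "4 * exp (- (3 * t)) \<le> (exp t * exp t) * exp (- (3 * t))"
        by (intro mult_right_mono) auto
      also have "\<dots> = exp (- t)"
        by (simp flip: exp_add)
      finally show ?thesis .
    qed
    finally show ?thesis .
  qed
  moreover have "measure M {\<omega> \<in> space M. norm (X \<omega>) \<le> b}
      = 1 - measure M {\<omega> \<in> space M. b < norm (X \<omega>)}"
    by (subst prob_compl[symmetric]) (auto intro!: arg_cong[where f="measure M"])
  ultimately show ?thesis
    by (simp add: b_def m_def T_def L_def)
qed

end
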